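(* Let $G$ be a finite group. Then there exists a finite partially ordered set $P$ with exactly $4|G|$ points whose automorphism group $\mathrm{Aut}(P)$ is isomorphic to $G$. Moreover, $P$ can be taken such that the action of $G\simeq \mathrm{Aut}(P)$ on the set of points of $P$ is free, that is, this action has exactly $4$ orbits.
   Context: A poset is a partially ordered set. An automorphism of a poset $P$ is a bijection $\varphi: P\to P$ such that $x\le y$ if and only if $\varphi(x)\le \varphi(y)$; $\mathrm{Aut}(P)$ is the group of all automorphisms under composition. It acts on $P$ by evaluation, and $G$ acts on $P$ through the isomorphism $G\simeq \mathrm{Aut}(P)$. An action is free if every non-identity group element fixes no point. *)

theory Defs
  imports "HOL-Algebra.Algebra"
begin

(* A poset is a set P with a relation r such that partial_order_on P r; (x, y) \<in> r means x \<le> y.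
   As in HOL-Algebra.Bij, self-bijections of P are extensional functions. *)

definition poset_auto :: "'p set \<Rightarrow> 'p rel \<Rightarrow> ('p \<Rightarrow> 'p) set"
  where "poset_auto P r = {f \<in> Bij P. \<forall>x\<in>P. \<forall>y\<in>P. (x, y) \<in> r \<longleftrightarrow> (f x, f y) \<in> r}"

definition poset_AutoGroup :: "'p set \<Rightarrow> 'p rel \<Rightarrow> ('p \<Rightarrow> 'p) monoid"
  where "poset_AutoGroup P r = BijGroup P \<lparr>carrier := poset_auto P r\<rparr>"

definition free_action :: "('g, 'c) monoid_scheme \<Rightarrow> 'p set \<Rightarrow> ('g \<Rightarrow> 'p \<Rightarrow> 'p) \<Rightarrow> bool"
  where "free_action G P \<phi> \<longleftrightarrow>
    group_action G P \<phi> \<and> (\<forall>g\<in>carrier G. g \<noteq> \<one>\<^bsub>G\<^esub> \<longrightarrow> (\<forall>x\<in>P. \<phi> g x \<noteq> x))"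

lemma subgroup_poset_auto: "subgroup (poset_auto P r) (BijGroup P)"
proof (rule subgroup.intro)
  show "poset_auto P r \<subseteq> carrier (BijGroup P)"
    by (auto simp: poset_auto_def BijGroup_def)
next
  fix f g assume "f \<in> poset_auto P r" "g \<in> poset_auto P r"
  then show "f \<otimes>\<^bsub>BijGroup P\<^esub> g \<in> poset_auto P r"
    using Bij_imp_funcset[of g P]
    by (auto simp: poset_auto_def BijGroup_def compose_Bij compose_eq Pi_iff)
next
  show "\<one>\<^bsub>BijGroup P\<^esub> \<in> poset_auto P r"
    by (auto simp: poset_auto_def BijGroup_def id_Bij)
next
  fix f assume f: "f \<in> poset_auto P r"
  then have B: "f \<in> Bij P" by (simp add: poset_auto_def)
  then have im: "f ` P = P" by (simp add: Bij_def bij_betw_def)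
  have "(x, y) \<in> r \<longleftrightarrow> (inv_into P f x, inv_into P f y) \<in> r" if "x \<in> P" "y \<in> P" for x y
  proof -
    have "f (inv_into P f x) = x" "f (inv_into P f y) = y"
      using that im by (simp_all add: f_inv_into_f)
    moreover have "inv_into P f x \<in> P" "inv_into P f y \<in> P"
      using that B by (simp_all add: Bij_inv_into_mem)
    ultimately show ?thesis
      using f by (force simp: poset_auto_def)
  qed
  then show "inv\<^bsub>BijGroup P\<^esub> f \<in> poset_auto P r"
    using B by (simp add: inv_BijGroup restrict_inv_into_Bij poset_auto_def)
qed

lemma group_poset_AutoGroup: "group (poset_AutoGroup P r)"
  unfolding poset_AutoGroup_def
  by (rule subgroup.subgroup_is_group[OF subgroup_poset_auto group_BijGroup])

lemma group_action_of_poset_iso: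
  assumes "group G" "\<phi> \<in> iso G (poset_AutoGroup P r)"
  shows "group_action G P \<phi>"
proof -
  have "poset_auto P r \<subseteq> carrier (BijGroup P)"
    using subgroup_poset_auto by (rule subgroup.subset)
  then have "\<phi> \<in> hom G (BijGroup P)"
    using assms(2) by (fastforce simp: iso_def hom_def poset_AutoGroup_def)
  then show ?thesis
    using assms(1) group_BijGroup
    by (auto simp: group_action_def group_hom_def group_hom_axioms_def)
qed

end

theory Submission
  imports Defs
begin

text \<open>
  The poset consists of four copies of \<open>G\<close>, stacked as levels \<open>0, 1, 2, 3\<close>, on which \<open>G\<close> acts by
  left multiplication.  Whether \<open>(x, i) \<le> (y, j)\<close> depends only on the levels and on \<open>x\<inverse> y\<close>, so every
  left translation is an automorphism, and the action is free with the levels as orbits.  The task is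
  to choose the order so that nothing else is an automorphism.

  Between consecutive levels only \<open>(x, i) < (x, i + 1)\<close> is imposed.  This makes every point of level
  \<open>i\<close> the member number \<open>i\<close> of a four-element chain, so automorphisms preserve levels, and they act by
  one and the same permutation \<open>F\<close> of \<open>G\<close> on each level.  Transitivity then only forces \<open>(x, i) < (x, j)\<close>
  for \<open>i < j\<close>, and that levels \<open>0\<close> and \<open>3\<close> are related at least as much as \<open>0\<close> and \<open>2\<close>, and as \<open>1\<close> and
  \<open>3\<close>.  Hence two arbitrary sets \<open>A, B \<subseteq> G\<close> containing the identity can be used: \<open>A\<close> between levels
  \<open>0\<close> and \<open>2\<close>, and \<open>B\<close> between \<open>1\<close> and \<open>3\<close>.  The automorphism group is now contained in the group of
  common automorphisms \<open>F\<close> of the Cayley digraphs of \<open>G\<close> with connection sets \<open>A\<close> and \<open>B\<close>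
  (\<open>auto_eq_translate\<close>).

  It remains to find \<open>A\<close> and \<open>B\<close> for which these common automorphisms are only the translations.
  Choose \<open>h\<^sub>0 = 1, h\<^sub>1, \<dots>, h\<^sub>r\<close> generating \<open>G\<close> such that no \<open>h\<^sub>j\<close> with \<open>j > 0\<close> lies in the subgroup generated
  by its predecessors.  Take \<open>A = {h\<^sub>0, \<dots>, h\<^sub>r}\<close>, and let \<open>B\<close> consist of \<open>1\<close> and the quotients
  \<open>h\<^sub>i\<inverse> h\<^bsub>i+1\<^esub>\<close>.  The \<open>A\<close>-neighbours of \<open>g\<close> are the \<open>g h\<^sub>i\<close>, and \<open>B\<close> joins them into a path starting at
  \<open>g\<close>.  Independence of the sequence excludes every \<open>B\<close>-arc that jumps ahead on this path
  (\<open>generator_chain_arc_imp\<close>), so \<open>F\<close> must carry the path at \<open>g\<close> to the path at \<open>F(g)\<close> point by point: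
  \<open>F(g h\<^sub>k) = F(g) h\<^sub>k\<close> (\<open>preserves_arcs_mult_generator\<close>).  Since the \<open>h\<^sub>k\<close> generate \<open>G\<close>, it follows
  that \<open>F(x) = F(1) x\<close>.
\<close>

section \<open>Rigid pairs of Cayley digraphs\<close>

text \<open>
  The value \<open>h 0 = \<one>\<close> makes \<open>h 1\<close> itself the first quotient \<open>inv (h 0) \<otimes> h 1\<close>, so that the first
  generator is marked in the same way as the passage from each generator to the next.
\<close>

definition generator_chain :: "('g, 'c) monoid_scheme \<Rightarrow> (nat \<Rightarrow> 'g) \<Rightarrow> nat \<Rightarrow> bool"
  where "generator_chain G h r \<longleftrightarrow> h 0 = \<one>\<^bsub>G\<^esub> \<and> h ` {..r} \<subseteq> carrier G \<and>
    (\<forall>j. 0 < j \<and> j \<le> r \<longrightarrow> h j \<notin> generate G (h ` {..<j}))"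

definition steps :: "('g, 'c) monoid_scheme \<Rightarrow> (nat \<Rightarrow> 'g) \<Rightarrow> nat \<Rightarrow> 'g set"
  where "steps G h r = insert \<one>\<^bsub>G\<^esub> {inv\<^bsub>G\<^esub> (h i) \<otimes>\<^bsub>G\<^esub> h (Suc i) | i. i < r}"

text \<open>
  The arcs of the Cayley digraph with connection set \<open>A\<close> are the pairs \<open>(x, x a)\<close> with \<open>a \<in> A\<close>.
\<close>

definition preserves_arcs :: "('g, 'c) monoid_scheme \<Rightarrow> 'g set \<Rightarrow> ('g \<Rightarrow> 'g) \<Rightarrow> bool"
  where "preserves_arcs G A F \<longleftrightarrow>
    (\<forall>x\<in>carrier G. \<forall>y\<in>carrier G. inv\<^bsub>G\<^esub> x \<otimes>\<^bsub>G\<^esub> y \<in> A \<longrightarrow> inv\<^bsub>G\<^esub> (F x) \<otimes>\<^bsub>G\<^esub> F y \<in> A)"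

context group
begin

lemma inv_mult_cancel_left:
  assumes "x \<in> carrier G" "y \<in> carrier G"
  shows "x \<otimes> (inv x \<otimes> y) = y" "inv x \<otimes> (x \<otimes> y) = y"
  using assms by (simp_all add: m_assoc[symmetric])

lemma inv_mult_translate:
  assumes "g \<in> carrier G" "x \<in> carrier G" "y \<in> carrier G"
  shows "inv (g \<otimes> x) \<otimes> (g \<otimes> y) = inv x \<otimes> y"
  using assms by (simp add: inv_mult_group m_assoc inv_mult_cancel_left)

lemma inv_mult_eq_one_iff:
  assumes "x \<in> carrier G" "y \<in> carrier G"
  shows "inv x \<otimes> y = \<one> \<longleftrightarrow> x = y"
proof
  assume "inv x \<otimes> y = \<one>"
  then have "x \<otimes> (inv x \<otimes> y) = x"
    using assms by simp
  then show "x = y"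
    using assms by (simp add: m_assoc[symmetric])
qed (use assms in simp)

lemma generator_chain_neq:
  assumes "generator_chain G h r" "i < j" "j \<le> r"
  shows "h i \<noteq> h j"
proof
  assume "h i = h j"
  moreover have "h i \<in> generate G (h ` {..<j})"
    using assms by (intro generate.incl) auto
  ultimately show False
    using assms by (auto simp: generator_chain_def)
qed

text \<open>
  Chains are repetition-free, so there is a longest one; if it did not generate, any element outside
  the generated subgroup would prolong it.
\<close>

lemma ex_generator_chain:
  assumes "finite (carrier G)"
  shows "\<exists>h r. generator_chain G h r \<and> generate G (h ` {..r}) = carrier G"
proof -
  define Q where "Q r \<longleftrightarrow> (\<exists>h. generator_chain G h r)" for r
  have bound: "r \<le> card (carrier G)" if Qr: "Q r" for r
  proof -
    obtain h where h: "generator_chain G h r"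
      using Qr by (auto simp: Q_def)
    have "inj_on h {..r}"
      by (intro linorder_inj_onI) (use generator_chain_neq[OF h] in auto)
    then have "card {..r} \<le> card (carrier G)"
      using h assms by (intro card_inj_on_le) (auto simp: generator_chain_def)
    then show ?thesis by simp
  qed
  have "Q 0"
    unfolding Q_def generator_chain_def by (rule exI[of _ "\<lambda>_. \<one>"]) auto
  then obtain r where r: "Q r" and max: "\<And>s. Q s \<Longrightarrow> s \<le> r"
    using GreatestI_nat[of Q] Greatest_le_nat[of Q] bound by metis
  obtain h where h: "generator_chain G h r"
    using r by (auto simp: Q_def)
  have "carrier G \<subseteq> generate G (h ` {..r})"
  proof (rule ccontr)
    assume "\<not> carrier G \<subseteq> generate G (h ` {..r})"
    then obtain x where x: "x \<in> carrier G" "x \<notin> generate G (h ` {..r})"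
      by auto
    define h' where "h' = h(Suc r := x)"
    \<comment> \<open>Changing \<open>h\<close> beyond \<open>r\<close> leaves the old independence conditions intact.\<close>
    have same: "h' ` {..<j} = h ` {..<j}" if "j \<le> Suc r" for j
      using that by (auto simp: h'_def)
    have "generator_chain G h' (Suc r)"
      unfolding generator_chain_def
    proof (intro conjI allI impI)
      show "h' 0 = \<one>" "h' ` {..Suc r} \<subseteq> carrier G"
        using h x by (auto simp: generator_chain_def h'_def image_subset_iff)
      fix j assume j: "0 < j \<and> j \<le> Suc r"
      show "h' j \<notin> generate G (h' ` {..<j})"
      proof (cases "j = Suc r")
        case True
        then show ?thesis
          using x same[of j] by (simp add: h'_def lessThan_Suc_atMost)
      next
        case False
        then show ?thesis
          using j h same[of j] by (simp add: h'_def generator_chain_def)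
      qed
    qed
    then show False
      using max[of "Suc r"] by (auto simp: Q_def)
  qed
  then have "generate G (h ` {..r}) = carrier G"
    using h generate_incl by (auto simp: generator_chain_def)
  with h show ?thesis by blast
qed

text \<open>
  An equation \<open>inv (h m) \<otimes> h j = inv (h i) \<otimes> h (Suc i)\<close> expresses whichever of \<open>h j\<close> and \<open>h (Suc i)\<close>
  has the larger index through elements of smaller index, against independence.  So the two indices
  agree, and cancelling leaves \<open>m = i\<close>.  Arcs pointing backwards (\<open>j < m\<close>) may exist, for instance when
  a quotient is an involution.
\<close>

lemma generator_chain_arc_imp:
  assumes h: "generator_chain G h r" and "m < j" "j \<le> r"
    and arc: "inv (h m) \<otimes> h j \<in> steps G h r"
  shows "j = Suc m"
proof -
  have C: "h i \<in> carrier G" if "i \<le> r" for i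
    using h that by (auto simp: generator_chain_def)
  have span: "h i \<in> generate G (h ` {..<l})" if "i < l" for i l
    using that by (intro generate.incl) auto
  have indep: "h l \<notin> generate G (h ` {..<l})" if "0 < l" "l \<le> r" for l
    using h that by (auto simp: generator_chain_def)
  have triple: "h a \<otimes> inv (h b) \<otimes> h c \<in> generate G (h ` {..<l})"
    if "a < l" "b < l" "c < l" "l \<le> r" for a b c l
    using that C
    by (intro generate.eng generate_m_inv_closed span) auto
  have "inv (h m) \<otimes> h j \<noteq> \<one>"
    using generator_chain_neq[OF h, of m j] assms C[of m] C[of j]
    by (simp add: inv_mult_eq_one_iff)
  then obtain i where i: "i < r" and eq: "inv (h m) \<otimes> h j = inv (h i) \<otimes> h (Suc i)"
    using arc by (auto simp: steps_def)
  have hm: "h m \<in> carrier G" "h j \<in> carrier G" "h i \<in> carrier G" "h (Suc i) \<in> carrier G"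
    using C assms i by auto
  consider "Suc i < j" | "j < Suc i" | "j = Suc i" by linarith
  then show ?thesis
  proof cases
    case 1
    have "h j = h m \<otimes> (inv (h m) \<otimes> h j)"
      using hm by (simp add: m_assoc[symmetric])
    also have "\<dots> = h m \<otimes> inv (h i) \<otimes> h (Suc i)"
      using hm by (simp add: eq m_assoc)
    finally show ?thesis
      using triple[of m j i "Suc i"] indep[of j] 1 assms by simp
  next
    case 2
    have "h (Suc i) = h i \<otimes> (inv (h i) \<otimes> h (Suc i))"
      using hm by (simp add: m_assoc[symmetric])
    also have "\<dots> = h i \<otimes> inv (h m) \<otimes> h j"
      using hm by (simp add: eq[symmetric] m_assoc)
    finally show ?thesis
      using triple[of i "Suc i" m j] indep[of "Suc i"] 2 assms i by simp
  next
    case 3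
    then have "inv (h m) = inv (h i)"
      using eq hm by simp
    then have "h m = h i"
      using hm by (metis inv_inv)
    then show ?thesis
      using generator_chain_neq[OF h, of m i] 3 assms by (cases "m = i") auto
  qed
qed

text \<open>
  Induction along the path \<open>g \<otimes> h 0, g \<otimes> h 1, \<dots>\<close>.  The image of \<open>g \<otimes> h k\<close> is \<open>F g \<otimes> h j\<close> for some \<open>j\<close>,
  because \<open>F\<close> preserves the first digraph.  By injectivity \<open>j\<close> is not below \<open>k\<close>, as those places are
  taken, and an arc of the second digraph from \<open>F g \<otimes> h (k - 1)\<close> cannot lead beyond \<open>F g \<otimes> h k\<close>.
\<close>

lemma preserves_arcs_mult_generator:
  assumes h: "generator_chain G h r"
    and F: "F \<in> carrier G \<rightarrow> carrier G" "inj_on F (carrier G)"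
    and A: "preserves_arcs G (h ` {..r}) F" and B: "preserves_arcs G (steps G h r) F"
    and g: "g \<in> carrier G" and "k \<le> r"
  shows "F (g \<otimes> h k) = F g \<otimes> h k"
  using \<open>k \<le> r\<close>
proof (induction k rule: less_induct)
  case (less k)
  have C: "h i \<in> carrier G" if "i \<le> r" for i
    using h that by (auto simp: generator_chain_def)
  have FC: "F x \<in> carrier G" if "x \<in> carrier G" for x
    using F that by auto
  show ?case
  proof (cases k)
    case 0
    then show ?thesis
      using h g FC by (simp add: generator_chain_def)
  next
    case (Suc m)
    have hk: "h k \<in> carrier G" and hm: "h m \<in> carrier G"
      using C less.prems Suc by auto
    have "inv g \<otimes> (g \<otimes> h k) \<in> h ` {..r}"
      using g hk less.prems by (simp add: m_assoc[symmetric])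
    then have "inv (F g) \<otimes> F (g \<otimes> h k) \<in> h ` {..r}"
      using A g hk by (simp add: preserves_arcs_def)
    then obtain j where j: "j \<le> r" and hj: "inv (F g) \<otimes> F (g \<otimes> h k) = h j"
      by auto
    have hjC: "h j \<in> carrier G" using C j by auto
    have Fk: "F (g \<otimes> h k) = F g \<otimes> h j"
      using g hk FC by (simp add: hj[symmetric] m_assoc[symmetric])
    have Fm: "F (g \<otimes> h m) = F g \<otimes> h m"
      using less.IH less.prems Suc by simp
    have "inv (g \<otimes> h m) \<otimes> (g \<otimes> h k) = inv (h m) \<otimes> h k"
      using g hk hm by (simp add: inv_mult_translate)
    moreover have "inv (h m) \<otimes> h k \<in> steps G h r"
      using less.prems Suc by (auto simp: steps_def)
    ultimately have "inv (F (g \<otimes> h m)) \<otimes> F (g \<otimes> h k) \<in> steps G h r"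
      using B g hk hm by (simp add: preserves_arcs_def)
    moreover have "inv (F (g \<otimes> h m)) \<otimes> F (g \<otimes> h k) = inv (h m) \<otimes> h j"
      using g hm hjC FC by (simp add: Fk Fm inv_mult_translate)
    ultimately have arc: "inv (h m) \<otimes> h j \<in> steps G h r" by simp
    have "m < j"
    proof (rule ccontr)
      assume "\<not> m < j"
      then have "j < k" using Suc by simp
      then have "F (g \<otimes> h j) = F (g \<otimes> h k)"
        using less.IH less.prems Fk by simp
      then have "h j = h k"
        using F(2) g hjC hk by (auto dest: inj_onD)
      then show False
        using generator_chain_neq[OF h \<open>j < k\<close>] less.prems by simp
    qed
    then have "j = k"
      using generator_chain_arc_imp[OF h _ j arc] Suc by simp
    then show ?thesis using Fk by simp
  qed
qed

text \<open>
  The elements \<open>x\<close> with \<open>F (g \<otimes> x) = F g \<otimes> x\<close> for all \<open>g\<close> form a subgroup; quantifying over \<open>g\<close> is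
  what makes the induction over generated elements go through.
\<close>

lemma preserves_arcs_imp_translation:
  assumes h: "generator_chain G h r" and gen: "generate G (h ` {..r}) = carrier G"
    and F: "F \<in> carrier G \<rightarrow> carrier G" "inj_on F (carrier G)"
    and A: "preserves_arcs G (h ` {..r}) F" and B: "preserves_arcs G (steps G h r) F"
    and x: "x \<in> carrier G"
  shows "F x = F \<one> \<otimes> x"
proof -
  have FC: "F y \<in> carrier G" if "y \<in> carrier G" for y
    using F that by auto
  have C: "h ` {..r} \<subseteq> carrier G"
    using h by (simp add: generator_chain_def)
  have one_gen: "F (g \<otimes> s) = F g \<otimes> s" if "s \<in> h ` {..r}" "g \<in> carrier G" for g s
    using preserves_arcs_mult_generator[OF h F A B] that by auto
  have "\<forall>g\<in>carrier G. F (g \<otimes> x) = F g \<otimes> x" if "x \<in> generate G (h ` {..r})"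
    using that
  proof (induction rule: generate.induct)
    case one
    show ?case using FC by simp
  next
    case (incl s)
    then show ?case using one_gen by blast
  next
    case (inv s)
    show ?case
    proof
      fix g assume g: "g \<in> carrier G"
      have s: "s \<in> carrier G" using inv C by auto
      have "F g = F (g \<otimes> inv s \<otimes> s)"
        using g s by (simp add: m_assoc)
      also have "\<dots> = F (g \<otimes> inv s) \<otimes> s"
        using inv g s by (simp add: one_gen)
      finally show "F (g \<otimes> inv s) = F g \<otimes> inv s"
        using g s FC by (simp add: m_assoc)
    qed
  next
    case (eng a b)
    have "a \<in> carrier G" "b \<in> carrier G"
      using eng gen by auto
    then show ?case
      using eng.IH FC by (simp add: m_assoc[symmetric])
  qed
  then show ?thesis
    using x gen by (auto dest: bspec[of _ _ \<one>])
qed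

end

section \<open>Four levels over a group\<close>

text \<open>
  The point type stays abstract: \<open>pt g i\<close> is any injective naming of the copy of \<open>g\<close> on level \<open>i\<close>, so
  that the construction can be carried out inside the natural numbers.
\<close>

locale four_levels = group G for G (structure) +
  fixes A B :: "'a set" and pt :: "'a \<Rightarrow> nat \<Rightarrow> 'p"
  assumes one_in_A: "\<one> \<in> A" and one_in_B: "\<one> \<in> B"
    and pt_eq_iff: "\<lbrakk>g \<in> carrier G; g' \<in> carrier G; i < 4; j < 4\<rbrakk>
      \<Longrightarrow> pt g i = pt g' j \<longleftrightarrow> g = g' \<and> i = j"
begin

text \<open>
  The quotients \<open>inv x \<otimes> y\<close> for which the copy of \<open>x\<close> on level \<open>i\<close> lies below the copy of \<open>y\<close> on level
  \<open>j\<close>.  The union between the levels \<open>0\<close> and \<open>3\<close> is the least choice that is transitive.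
\<close>

definition gap :: "nat \<Rightarrow> nat \<Rightarrow> 'a set"
  where "gap i j = (if j < i then {} else if (i, j) = (0, 2) then A
    else if (i, j) = (1, 3) then B else if (i, j) = (0, 3) then A \<union> B else {\<one>})"

definition points :: "'p set"
  where "points = {pt g i | g i. g \<in> carrier G \<and> i < 4}"

definition le :: "'p rel"
  where "le = {(pt g i, pt g' j) | g g' i j. g \<in> carrier G \<and> g' \<in> carrier G \<and>
    i < 4 \<and> j < 4 \<and> inv g \<otimes> g' \<in> gap i j}"

definition translate :: "'a \<Rightarrow> 'p \<Rightarrow> 'p"
  where "translate g = (\<lambda>x\<in>points. THE y. \<exists>h i. h \<in> carrier G \<and> i < 4 \<and>
    x = pt h i \<and> y = pt (g \<otimes> h) i)"

lemma pt_in_points: "g \<in> carrier G \<Longrightarrow> i < 4 \<Longrightarrow> pt g i \<in> points"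
  by (auto simp: points_def)

lemma pointsE:
  assumes "x \<in> points"
  obtains g i where "g \<in> carrier G" "i < 4" "x = pt g i"
  using assms by (auto simp: points_def)

lemma pt_le_iff:
  assumes "g \<in> carrier G" "g' \<in> carrier G" "i < 4" "j < 4"
  shows "(pt g i, pt g' j) \<in> le \<longleftrightarrow> inv g \<otimes> g' \<in> gap i j"
  using assms by (auto simp: le_def pt_eq_iff)

lemma gap_Suc: "gap j (Suc j) = {\<one>}"
  by (auto simp: gap_def)

text \<open>
  This is transitivity of the order.  If one of the two steps stays on its level it contributes the
  factor \<open>\<one>\<close>.  Otherwise at least one step goes between consecutive levels and contributes
  \<open>\<one>\<close> as well, so the product is the other factor, and the set between the outer levels was chosen
  large enough to contain it.
\<close>

lemma gap_mult:
  assumes "x \<in> gap i j" "y \<in> gap j k" "x \<in> carrier G" "y \<in> carrier G" "k < 4"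
  shows "x \<otimes> y \<in> gap i k"
proof -
  have "i \<le> j" "j \<le> k"
    using assms(1,2) by (auto simp: gap_def split: if_splits)
  then consider "i = j" | "j = k" | "i < j" "j < k" by linarith
  then show ?thesis
  proof cases
    case 1
    then have "x = \<one>"
      using assms(1) by (simp add: gap_def split: if_splits)
    then show ?thesis
      using assms 1 by simp
  next
    case 2
    then have "y = \<one>"
      using assms(2) by (simp add: gap_def split: if_splits)
    then show ?thesis
      using assms 2 by simp
  next
    case 3
    then consider "i = 0" "j = 1" "k = 2" | "i = 0" "j = 1" "k = 3"
      | "i = 0" "j = 2" "k = 3" | "i = 1" "j = 2" "k = 3"
      using \<open>k < 4\<close> by linarith
    then show ?thesis
      using assms one_in_A one_in_B by cases (auto simp: gap_def)
  qed
qed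

lemma partial_order_le: "partial_order_on points le"
  unfolding partial_order_on_def preorder_on_def
proof (intro conjI)
  show "le \<subseteq> points \<times> points"
    by (auto simp: le_def points_def)
  show "refl_on points le"
    by (auto simp: refl_on_def gap_def pt_le_iff elim!: pointsE)
  show "trans le"
  proof (rule transI)
    fix x y z assume xy: "(x, y) \<in> le" and yz: "(y, z) \<in> le"
    obtain f i g j where x: "x = pt f i" and y: "y = pt g j"
      and c1: "f \<in> carrier G" "g \<in> carrier G" "i < 4" "j < 4" "inv f \<otimes> g \<in> gap i j"
      using xy by (auto simp: le_def)
    obtain h k where z: "z = pt h k" and c2: "h \<in> carrier G" "k < 4" "inv g \<otimes> h \<in> gap j k"
      using yz c1 by (auto simp: le_def y pt_eq_iff)
    have "(inv f \<otimes> g) \<otimes> (inv g \<otimes> h) \<in> gap i k"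
      using gap_mult c1 c2 by simp
    also have "(inv f \<otimes> g) \<otimes> (inv g \<otimes> h) = inv f \<otimes> h"
      using c1 c2 by (simp add: m_assoc inv_mult_cancel_left)
    finally show "(x, z) \<in> le"
      using c1 c2 by (simp add: x z pt_le_iff)
  qed
  show "antisym le"
  proof (rule antisymI)
    fix x y assume xy: "(x, y) \<in> le" and yx: "(y, x) \<in> le"
    obtain f i g j where x: "x = pt f i" and y: "y = pt g j"
      and c: "f \<in> carrier G" "g \<in> carrier G" "i < 4" "j < 4" "inv f \<otimes> g \<in> gap i j"
      using xy by (auto simp: le_def)
    have "inv g \<otimes> f \<in> gap j i"
      using yx c by (simp add: x y pt_le_iff)
    then have "i = j"
      using c by (auto simp: gap_def split: if_splits)
    then show "x = y"
      using c inv_mult_eq_one_iff[of f g] by (simp add: x y gap_def split: if_splits)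
  qed
qed

lemma translate_pt:
  assumes "g \<in> carrier G" "h \<in> carrier G" "i < 4"
  shows "translate g (pt h i) = pt (g \<otimes> h) i"
  using assms by (auto simp: translate_def pt_in_points pt_eq_iff intro!: the_equality)

lemma translate_in_auto:
  assumes g: "g \<in> carrier G"
  shows "translate g \<in> poset_auto points le"
proof -
  have "bij_betw (translate g) points points"
  proof (rule bij_betw_byWitness[where f' = "translate (inv g)"])
    show "\<forall>x\<in>points. translate (inv g) (translate g x) = x"
      using g by (auto simp: translate_pt m_assoc[symmetric] elim!: pointsE)
    show "\<forall>x\<in>points. translate g (translate (inv g) x) = x"
      using g by (auto simp: translate_pt m_assoc[symmetric] elim!: pointsE)
    show "translate g ` points \<subseteq> points"
      using g by (auto simp: translate_pt pt_in_points elim!: pointsE)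
    show "translate (inv g) ` points \<subseteq> points"
      using g by (auto simp: translate_pt pt_in_points elim!: pointsE)
  qed
  then show ?thesis
    using g
    by (auto simp: poset_auto_def Bij_def translate_pt pt_le_iff inv_mult_translate elim!: pointsE)
      (simp add: translate_def)
qed

text \<open>
  The four copies of \<open>g\<close> form a chain, and the level increases strictly along any chain.  The image
  of this chain thus has levels \<open>0, 1, 2, 3\<close> in order.
\<close>

lemma auto_preserves_level:
  assumes f: "f \<in> poset_auto points le" and g: "g \<in> carrier G" and i: "i < 4"
  shows "\<exists>g'\<in>carrier G. f (pt g i) = pt g' i"
proof -
  have "f ` points = points" and inj: "inj_on f points"
    using f by (auto simp: poset_auto_def Bij_def bij_betw_def)
  then have "\<exists>x k. x \<in> carrier G \<and> k < 4 \<and> f (pt g j) = pt x k" if "j < 4" for j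
    using that g pt_in_points[of g j] by (metis imageI pointsE)
  then obtain c L where cL: "\<And>j. j < 4 \<Longrightarrow> c j \<in> carrier G \<and> L j < 4 \<and> f (pt g j) = pt (c j) (L j)"
    by metis
  have up: "L j < L (Suc j)" if "Suc j < 4" for j
  proof -
    have "(pt g j, pt g (Suc j)) \<in> le"
      using that g by (simp add: pt_le_iff gap_Suc)
    then have "(f (pt g j), f (pt g (Suc j))) \<in> le"
      using f g that by (auto simp: poset_auto_def pt_in_points)
    then have le: "inv (c j) \<otimes> c (Suc j) \<in> gap (L j) (L (Suc j))"
      using cL[of j] cL[of "Suc j"] that by (auto simp: pt_le_iff)
    have "f (pt g j) \<noteq> f (pt g (Suc j))"
      using inj g that by (auto simp: inj_on_eq_iff pt_in_points pt_eq_iff)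
    then have "\<not> (c j = c (Suc j) \<and> L j = L (Suc j))"
      using cL[of j] cL[of "Suc j"] that by auto
    then show ?thesis
      using le cL[of j] cL[of "Suc j"] that inv_mult_eq_one_iff[of "c j" "c (Suc j)"]
      by (auto simp: gap_def not_less_iff_gr_or_eq split: if_splits)
  qed
  have "L 0 < L 1" "L 1 < L 2" "L 2 < L 3" "L 3 < 4"
    using up[of 0] up[of 1] up[of 2] cL[of 3] by (auto simp: numeral_eq_Suc)
  then have "L i = i"
    using i by (auto simp: numeral_eq_Suc less_Suc_eq)
  then show ?thesis
    using cL[OF i] by metis
qed

text \<open>
  The only point of level \<open>j + 1\<close> above the copy of \<open>x\<close> on level \<open>j\<close> is the copy of \<open>x\<close>, so the
  permutation induced on one level determines the one on the next, and they are equal.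
\<close>

lemma auto_same_on_levels:
  assumes f: "f \<in> poset_auto points le"
  shows "\<exists>F \<in> carrier G \<rightarrow> carrier G. \<forall>g\<in>carrier G. \<forall>i<4. f (pt g i) = pt (F g) i"
proof -
  obtain c where c: "\<And>g i. g \<in> carrier G \<Longrightarrow> i < 4 \<Longrightarrow> c g i \<in> carrier G \<and> f (pt g i) = pt (c g i) i"
    using auto_preserves_level[OF f] by metis
  have step: "c g (Suc j) = c g j" if "g \<in> carrier G" "Suc j < 4" for g j
  proof -
    have "(pt g j, pt g (Suc j)) \<in> le"
      using that by (simp add: pt_le_iff gap_Suc)
    then have "(f (pt g j), f (pt g (Suc j))) \<in> le"
      using f that by (auto simp: poset_auto_def pt_in_points)
    then have "inv (c g j) \<otimes> c g (Suc j) \<in> gap j (Suc j)"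
      using c[of g j] c[of g "Suc j"] that by (auto simp: pt_le_iff)
    then show ?thesis
      using c[of g j] c[of g "Suc j"] that inv_mult_eq_one_iff[of "c g j" "c g (Suc j)"]
      by (simp add: gap_Suc)
  qed
  have same: "c g i = c g 0" if g: "g \<in> carrier G" and "i < 4" for g i
    using \<open>i < 4\<close>
  proof (induction i)
    case (Suc i)
    then show ?case using step[OF g, of i] by simp
  qed simp
  show ?thesis
  proof (intro bexI[of _ "\<lambda>g. c g 0"] ballI allI impI funcsetI)
    show "c g 0 \<in> carrier G" if "g \<in> carrier G" for g
      using c[OF that, of 0] by simp
    show "f (pt g i) = pt (c g 0) i" if "g \<in> carrier G" "i < 4" for g i
      using c[OF that] same[OF that] by simp
  qed
qed

text \<open>
  The order between the levels \<open>0\<close> and \<open>2\<close> is the Cayley digraph of \<open>A\<close>, and the order between \<open>1\<close>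
  and \<open>3\<close> is that of \<open>B\<close>.  The permutation common to all levels therefore preserves both digraphs.
\<close>

lemma auto_eq_translate:
  assumes rigid: "\<And>F. \<lbrakk>F \<in> carrier G \<rightarrow> carrier G; inj_on F (carrier G);
      preserves_arcs G A F; preserves_arcs G B F\<rbrakk> \<Longrightarrow> \<forall>x\<in>carrier G. F x = F \<one> \<otimes> x"
    and f: "f \<in> poset_auto points le"
  shows "\<exists>a\<in>carrier G. f = translate a"
proof -
  obtain F where F: "F \<in> carrier G \<rightarrow> carrier G"
    and fF: "\<And>g i. g \<in> carrier G \<Longrightarrow> i < 4 \<Longrightarrow> f (pt g i) = pt (F g) i"
    using auto_same_on_levels[OF f] by blast
  have FC: "F x \<in> carrier G" if "x \<in> carrier G" for x
    using F that by auto
  have inj: "inj_on f points"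
    using f by (auto simp: poset_auto_def Bij_def bij_betw_def)
  have injF: "inj_on F (carrier G)"
  proof (rule inj_onI)
    fix x y assume xy: "x \<in> carrier G" "y \<in> carrier G" "F x = F y"
    then have "f (pt x 0) = f (pt y 0)"
      by (simp add: fF)
    then have "pt x 0 = pt y 0"
      using xy inj by (simp add: inj_on_eq_iff pt_in_points)
    then show "x = y"
      using xy by (simp add: pt_eq_iff)
  qed
  have gap: "preserves_arcs G (gap i j) F" if "i < 4" "j < 4" for i j
    unfolding preserves_arcs_def
  proof (intro ballI impI)
    fix x y assume xy: "x \<in> carrier G" "y \<in> carrier G" and "inv x \<otimes> y \<in> gap i j"
    then have "(pt x i, pt y j) \<in> le"
      using that by (simp add: pt_le_iff)
    then have "(f (pt x i), f (pt y j)) \<in> le"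
      using f xy that by (simp add: poset_auto_def pt_in_points)
    then show "inv (F x) \<otimes> F y \<in> gap i j"
      using xy that FC by (simp add: fF pt_le_iff)
  qed
  have "preserves_arcs G A F" "preserves_arcs G B F"
    using gap[of 0 2] gap[of 1 3] by (simp_all add: gap_def)
  then have tr: "\<forall>x\<in>carrier G. F x = F \<one> \<otimes> x"
    by (rule rigid[OF F injF])
  have "f = translate (F \<one>)"
  proof
    fix x
    show "f x = translate (F \<one>) x"
    proof (cases "x \<in> points")
      case True
      then obtain g i where g: "g \<in> carrier G" "i < 4" and x: "x = pt g i"
        by (rule pointsE)
      then show ?thesis
        using FC[of \<one>] bspec[OF tr g(1)] by (simp add: fF translate_pt)
    next
      case False
      moreover have "f \<in> extensional points"
        using f by (simp add: poset_auto_def Bij_imp_extensional)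
      ultimately have "f x = undefined"
        by (rule extensional_arb[rotated])
      then show ?thesis
        using False by (simp add: translate_def)
    qed
  qed
  moreover have "F \<one> \<in> carrier G"
    using FC by simp
  ultimately show ?thesis by (rule bexI)
qed

lemma translate_iso:
  assumes autos: "\<And>f. f \<in> poset_auto points le \<Longrightarrow> \<exists>a\<in>carrier G. f = translate a"
  shows "translate \<in> iso G (poset_AutoGroup points le)"
proof -
  have inB: "translate g \<in> Bij points" if "g \<in> carrier G" for g
    using translate_in_auto[OF that] by (simp add: poset_auto_def)
  have "translate (g \<otimes> h) = compose points (translate g) (translate h)"
    if "g \<in> carrier G" "h \<in> carrier G" for g h
  proof
    fix x
    show "translate (g \<otimes> h) x = compose points (translate g) (translate h) x"
    proof (cases "x \<in> points")
      case True
      then obtain k i where "k \<in> carrier G" "i < 4" "x = pt k i"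
        by (rule pointsE)
      then show ?thesis
        using that by (simp add: compose_eq pt_in_points translate_pt m_assoc)
    next
      case False
      then show ?thesis
        by (simp add: translate_def compose_def)
    qed
  qed
  then have "translate \<in> hom G (poset_AutoGroup points le)"
    using inB translate_in_auto
    by (auto simp: hom_def poset_AutoGroup_def BijGroup_def)
  moreover have "inj_on translate (carrier G)"
  proof (rule inj_onI)
    fix g h assume gh: "g \<in> carrier G" "h \<in> carrier G" "translate g = translate h"
    then have "translate g (pt \<one> 0) = translate h (pt \<one> 0)" by simp
    then have "pt g 0 = pt h 0"
      using gh(1,2) by (simp add: translate_pt)
    then show "g = h"
      using gh(1,2) by (simp add: pt_eq_iff)
  qed
  moreover have "translate ` carrier G = poset_auto points le"
  proof
    show "translate ` carrier G \<subseteq> poset_auto points le"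
      by (intro image_subsetI translate_in_auto)
    show "poset_auto points le \<subseteq> translate ` carrier G"
      by (intro subsetI) (use autos in \<open>simp add: image_iff\<close>)
  qed
  ultimately show ?thesis
    by (simp add: iso_def bij_betw_def poset_AutoGroup_def)
qed

lemma translate_fixed_point_free:
  assumes "g \<in> carrier G" "g \<noteq> \<one>" "x \<in> points"
  shows "translate g x \<noteq> x"
  using assms by (auto simp: translate_pt pt_eq_iff elim!: pointsE)

lemma card_orbits: "card (orbits G points translate) = 4"
proof -
  define level where "level i = {pt g i | g. g \<in> carrier G}" for i
  have orb: "orbit G translate (pt h i) = level i" if h: "h \<in> carrier G" and i: "i < 4" for h i
  proof -
    have mem: "translate k (pt h i) \<in> level i" if "k \<in> carrier G" for k
      using that h i by (auto simp: level_def translate_pt)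
    have hit: "pt g i = translate (g \<otimes> inv h) (pt h i)" if "g \<in> carrier G" for g
      using that h i by (simp add: translate_pt m_assoc)
    show ?thesis
    proof
      show "orbit G translate (pt h i) \<subseteq> level i"
        using mem by (auto simp: orbit_def)
      show "level i \<subseteq> orbit G translate (pt h i)"
      proof
        fix y assume "y \<in> level i"
        then obtain g where g: "g \<in> carrier G" "y = pt g i"
          by (auto simp: level_def)
        then have "y = translate (g \<otimes> inv h) (pt h i)" "g \<otimes> inv h \<in> carrier G"
          using hit[of g] h by (simp_all only: m_closed inv_closed)
        then show "y \<in> orbit G translate (pt h i)"
          unfolding orbit_def by blast
      qed
    qed
  qed
  have "orbits G points translate = level ` {..<4}"
  proof
    show "orbits G points translate \<subseteq> level ` {..<4}"
      by (auto simp: orbits_def orb elim!: pointsE)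
    show "level ` {..<4} \<subseteq> orbits G points translate"
    proof
      fix Y assume "Y \<in> level ` {..<4}"
      then obtain i where "i < 4" "Y = level i" by auto
      then have "Y = orbit G translate (pt \<one> i)" "pt \<one> i \<in> points"
        using orb[of \<one> i] pt_in_points[of \<one> i] by auto
      then show "Y \<in> orbits G points translate"
        unfolding orbits_def by blast
    qed
  qed
  moreover have "inj_on level {..<4}"
  proof (rule inj_onI)
    fix i j :: nat assume ij: "i \<in> {..<4}" "j \<in> {..<4}" "level i = level j"
    have "pt \<one> i \<in> level i"
      by (auto simp: level_def)
    then have "pt \<one> i \<in> level j"
      using ij(3) by simp
    then obtain g where "g \<in> carrier G" "pt \<one> i = pt g j"
      by (auto simp: level_def)
    then show "i = j"
      using ij(1,2) by (simp add: pt_eq_iff)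
  qed
  ultimately show ?thesis by (simp add: card_image)
qed

lemma points_eq_image: "points = case_prod pt ` (carrier G \<times> {..<4})"
  by (auto simp: points_def)

lemma card_points: "card points = 4 * card (carrier G)"
proof -
  have "inj_on (case_prod pt) (carrier G \<times> {..<4})"
    by (auto simp: inj_on_def pt_eq_iff)
  then show ?thesis
    by (simp add: points_eq_image card_image card_cartesian_product)
qed

end

section \<open>Realization of a finite group on four orbits\<close>

theorem theorem2:
  fixes G :: "('g, 'c) monoid_scheme"
  assumes "group G" and "finite (carrier G)"
  shows "\<exists>(P :: nat set) r \<phi>.
    finite P \<and> partial_order_on P r \<and> card P = 4 * card (carrier G) \<and>
    \<phi> \<in> iso G (poset_AutoGroup P r) \<and>
    free_action G P \<phi> \<and> card (orbits G P \<phi>) = 4"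
proof -
  interpret group G by fact
  obtain h r where h: "generator_chain G h r" and gen: "generate G (h ` {..r}) = carrier G"
    using ex_generator_chain assms(2) by blast
  obtain e :: "'g \<Rightarrow> nat" where e: "inj_on e (carrier G)"
    using finite_imp_inj_to_nat_seg[OF assms(2)] by blast
  \<comment> \<open>The remainder modulo four is the level, and the quotient identifies the group element.\<close>
  define pt where "pt g i = 4 * e g + i" for g and i :: nat
  interpret four_levels G "h ` {..r}" "steps G h r" pt
  proof
    show "\<one>\<^bsub>G\<^esub> \<in> h ` {..r}"
      using h by (metis atMost_iff generator_chain_def image_eqI le0)
    show "\<one>\<^bsub>G\<^esub> \<in> steps G h r"
      by (simp add: steps_def)
    fix g g' and i j :: nat
    assume *: "g \<in> carrier G" "g' \<in> carrier G" "i < 4" "j < 4"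
    have "pt g i = pt g' j \<longleftrightarrow> e g = e g' \<and> i = j"
      using * unfolding pt_def by presburger
    then show "pt g i = pt g' j \<longleftrightarrow> g = g' \<and> i = j"
      using * e by (auto simp: inj_on_eq_iff)
  qed
  have iso: "translate \<in> iso G (poset_AutoGroup points le)"
    by (intro translate_iso auto_eq_translate ballI preserves_arcs_imp_translation[OF h gen])
  then have "free_action G points translate"
    using group_action_of_poset_iso[OF assms(1) iso] translate_fixed_point_free
    by (simp add: free_action_def)
  moreover have "finite points"
    using assms(2) by (simp add: points_eq_image)
  ultimately show ?thesis
    using partial_order_le card_points iso card_orbits by blast
qed

end
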